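(* Let $p\in[1,\infty]$ and let $Y_1,Y_2,\dots$ be a sequence of random variables in $L^p(\Omega,\mathscr F,\mathbb P)$ with $\sup_m\|Y_m\|_p<\infty$. Let $\{\beta_m\}_{m\in\mathbb N_0}$ be a sequence of real numbers with $\beta_m\ge 0$ for all $m$, and set $$Z_n:=\sum_{m=1}^n\beta_{n-m}Y_m,\qquad s_n^2:=\sum_{m=0}^{n-1}\beta_m^2,\quad s_n\ge 0,\qquad n\in\mathbb N.$$ Suppose that there exist $q>0$, $b>1$, and a slowly varying function $\ell$ such that $$\lim_{n\to\infty}\frac{s_n^2}{2^{2qn}\,\ell(b^n)}=1.$$ Then, as $n\to\infty$, $$\frac1{s_n}Z_n\longrightarrow Z:=\sqrt{2^{2q}-1}\,\sum_{m=1}^\infty 2^{-qm}Y_m\qquad\text{in }L^p.$$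
   Context: $(\Omega,\mathscr F,\mathbb P)$ is a given probability space. No independence or identical distribution of the $Y_m$ is assumed. A measurable, strictly positive function $g:[0,\infty)\to(0,\infty)$ is called regularly varying (at infinity) with index $\varrho\in\mathbb R$ if $g(\lambda x)/g(x)\to\lambda^\varrho$ as $x\uparrow\infty$ for every $\lambda>0$; it is called slowly varying if $\varrho=0$. $\mathbb N=\{1,2,\dots\}$ and $\mathbb N_0=\{0,1,2,\dots\}$. *)

theory Defs
  imports "HOL-Probability.Probability"
begin

definition regularly_varying :: "real \<Rightarrow> (real \<Rightarrow> real) \<Rightarrow> bool" where
  "regularly_varying \<rho> g \<longleftrightarrow>
     g \<in> borel_measurable (restrict_space borel {0..}) \<and>
     (\<forall>x\<ge>0. g x > 0) \<and>
     (\<forall>c>0. ((\<lambda>x. g (c * x) / g x) \<longlongrightarrow> c powr \<rho>) at_top)"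

definition slowly_varying :: "(real \<Rightarrow> real) \<Rightarrow> bool" where
  "slowly_varying g \<longleftrightarrow> regularly_varying 0 g"

text \<open>The norm is extended-valued, so that membership in the space is finiteness of the norm.
  There is no \<open>powr\<close> on \<^typ>\<open>ennreal\<close>, hence the separate clause for a divergent integral.\<close>

definition Lp_norm :: "'a measure \<Rightarrow> ennreal \<Rightarrow> ('a \<Rightarrow> real) \<Rightarrow> ennreal" where
  "Lp_norm M p f =
     (if p = \<infinity> then esssup M (\<lambda>\<omega>. ennreal \<bar>f \<omega>\<bar>)
      else let I = (\<integral>\<^sup>+ \<omega>. ennreal (\<bar>f \<omega>\<bar> powr enn2real p) \<partial>M)
           in if I = \<infinity> then \<infinity> else ennreal (enn2real I powr (1 / enn2real p)))"

definition Lp_space :: "'a measure \<Rightarrow> ennreal \<Rightarrow> ('a \<Rightarrow> real) set" where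
  "Lp_space M p = {f \<in> borel_measurable M. Lp_norm M p f < \<infinity>}"

definition tendsto_Lp ::
    "'a measure \<Rightarrow> ennreal \<Rightarrow> (nat \<Rightarrow> 'a \<Rightarrow> real) \<Rightarrow> ('a \<Rightarrow> real) \<Rightarrow> bool" where
  "tendsto_Lp M p X L \<longleftrightarrow>
     (\<forall>n. X n \<in> Lp_space M p) \<and> L \<in> Lp_space M p \<and>
     (\<lambda>n. Lp_norm M p (\<lambda>\<omega>. X n \<omega> - L \<omega>)) \<longlonglongrightarrow> 0"

definition weighted_sum ::
    "(nat \<Rightarrow> real) \<Rightarrow> (nat \<Rightarrow> 'a \<Rightarrow> real) \<Rightarrow> nat \<Rightarrow> 'a \<Rightarrow> real" where
  "weighted_sum \<beta> Y n \<omega> = (\<Sum>m=1..n. \<beta> (n - m) * Y m \<omega>)"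

definition weight_norm :: "(nat \<Rightarrow> real) \<Rightarrow> nat \<Rightarrow> real" where
  "weight_norm \<beta> n = sqrt (\<Sum>m<n. (\<beta> m)\<^sup>2)"

text \<open>The series is summed pointwise and indexed from \<open>0\<close>, its terms being those of
  \<open>m = 1, 2, \<dots>\<close>. At a point where it diverges the value of \<^const>\<open>suminf\<close> is unspecified.\<close>

definition limit_rv :: "real \<Rightarrow> (nat \<Rightarrow> 'a \<Rightarrow> real) \<Rightarrow> 'a \<Rightarrow> real" where
  "limit_rv q Y \<omega> =
     sqrt (2 powr (2 * q) - 1) * (\<Sum>m. 2 powr (- q * real (Suc m)) * Y (Suc m) \<omega>)"

end

theory Submission
  imports Defs
begin

text \<open>Since \<open>l(b\<^sup>n\<^sup>+\<^sup>1) / l(b\<^sup>n) \<longlonglongrightarrow> 1\<close>, the growth hypothesis gives \<open>s\<^sub>n\<^sub>+\<^sub>1 / s\<^sub>n \<longlonglongrightarrow> R = 2\<^sup>q\<close>. As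
  \<open>(\<beta>\<^sub>n / s\<^sub>n)\<^sup>2 = (s\<^sub>n\<^sub>+\<^sub>1 / s\<^sub>n)\<^sup>2 - 1\<close>, the coefficient \<open>\<beta>\<^sub>n\<^sub>-\<^sub>m / s\<^sub>n\<close> of \<open>Y\<^sub>m\<close> in \<open>Z\<^sub>n / s\<^sub>n\<close> tends to
  the coefficient \<open>sqrt (R\<^sup>2 - 1) R\<^sup>-\<^sup>m\<close> of \<open>Y\<^sub>m\<close> in \<open>Z\<close>. It is at most \<open>s\<^sub>n\<^sub>-\<^sub>m\<^sub>+\<^sub>1 / s\<^sub>n\<close>, which decays
  geometrically in \<open>m\<close> uniformly in \<open>n\<close>, so the convergence of coefficients holds in \<open>l\<^sup>1\<close>. This
  suffices, because \<open>\<Sum> c\<^sub>m Y\<^sub>m\<close> has \<open>L\<^sup>p\<close> norm at most \<open>sup \<parallel>Y\<^sub>m\<parallel>\<^sub>p\<close> times the \<open>l\<^sup>1\<close> norm of \<open>c\<close>. For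
  finite \<open>p\<close> that bound follows from convexity of \<open>x\<^sup>p\<close> with weights \<open>\<bar>c\<^sub>m\<bar>\<close>, which avoids
  Minkowski's inequality.\<close>

section \<open>Convexity of powers and a weighted power inequality\<close>

lemma convex_on_powr_nonneg:
  fixes p :: real
  assumes "p \<ge> 1"
  shows "convex_on {0..} (\<lambda>x. x powr p)"
proof (rule convex_onI)
  fix t x y :: real
  assume t: "0 < t" "t < 1" and xy: "x \<in> {0..}" "y \<in> {0..}"
  \<comment> \<open>With one point at 0 the convexity inequality reduces to this bound for the
    weight of the other point; two positive points are left to \<open>powr_convex\<close>. The
    endpoint matters because values |Y_m| may vanish.\<close>
  have shrink: "u powr p \<le> u" if "0 < u" "u < 1" for u :: real
    using powr_mono'[of 1 p u] that assms by simp
  consider "x = 0" | "y = 0" | "x > 0" "y > 0" using xy by fastforce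
  then show "((1 - t) *\<^sub>R x + t *\<^sub>R y) powr p \<le> (1 - t) * x powr p + t * y powr p"
  proof cases
    case 1
    then show ?thesis
      using shrink[OF t] t xy by (simp add: powr_mult mult_right_mono)
  next
    case 2
    then show ?thesis
      using shrink[of "1 - t"] t xy by (simp add: powr_mult mult_right_mono)
  next
    case 3
    then show ?thesis
      using convex_onD[OF powr_convex[OF assms], of t x y] t by simp
  qed
qed simp

text \<open>Jensen's inequality for the normalized weights \<open>w i / S\<close>, where S is the
  total weight; homogeneity gives the factor S^p = S^(p-1) * S, whose last S undoes the
  normalization. If S = 0, all weights vanish.\<close>

lemma weighted_sum_powr_le:
  fixes p :: real and w y :: "nat \<Rightarrow> real"
  assumes "p \<ge> 1" and w: "\<And>i. i \<in> A \<Longrightarrow> w i \<ge> 0" and y: "\<And>i. i \<in> A \<Longrightarrow> y i \<ge> 0"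
    and "finite A"
  shows "(\<Sum>i\<in>A. w i * y i) powr p \<le> (\<Sum>i\<in>A. w i) powr (p - 1) * (\<Sum>i\<in>A. w i * y i powr p)"
proof (cases "(\<Sum>i\<in>A. w i) = 0")
  case True
  then have "w i = 0" if "i \<in> A" for i
    using sum_nonneg_eq_0_iff[OF \<open>finite A\<close>, of w] w that by auto
  then show ?thesis by simp
next
  case False
  define S where "S = (\<Sum>i\<in>A. w i)"
  have S: "S > 0"
    using False w by (simp add: S_def sum_nonneg less_le)
  have ne: "A \<noteq> {}" using False by auto
  have eq: "(\<Sum>i\<in>A. w i * y i) = S * (\<Sum>i\<in>A. (w i / S) * y i)"
    using S by (simp add: sum_distrib_left)
  have "(\<Sum>i\<in>A. (w i / S) *\<^sub>R y i) powr p \<le> (\<Sum>i\<in>A. w i / S * y i powr p)"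
    by (rule convex_on_sum[OF \<open>finite A\<close> ne convex_on_powr_nonneg[OF \<open>p \<ge> 1\<close>]])
      (use S w y in \<open>auto simp: S_def simp flip: sum_divide_distrib\<close>)
  then have "(\<Sum>i\<in>A. w i * y i) powr p \<le> S powr p * (\<Sum>i\<in>A. w i / S * y i powr p)"
    unfolding eq using S w y by (simp add: powr_mult sum_nonneg)
  also have "S powr p = S powr (p - 1) * S"
    using S by (simp add: powr_diff)
  also have "S powr (p - 1) * S * (\<Sum>i\<in>A. w i / S * y i powr p) =
      S powr (p - 1) * (\<Sum>i\<in>A. w i * y i powr p)"
    using S by (simp add: sum_distrib_left)
  finally show ?thesis by (simp add: S_def)
qed

section \<open>Norm bounds and almost everywhere equality\<close>

text \<open>Removes the root and the case split of \<open>Lp_norm\<close>: one direction turns the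
  bounds on the Y_m into integral bounds, the other turns an integral bound for the series back into
  a norm bound.\<close>

lemma Lp_norm_le_iff_nn_integral:
  assumes "1 \<le> p" "p \<noteq> \<infinity>" "0 \<le> K"
  shows "Lp_norm M p f \<le> ennreal K \<longleftrightarrow>
    (\<integral>\<^sup>+ \<omega>. ennreal (\<bar>f \<omega>\<bar> powr enn2real p) \<partial>M) \<le> ennreal (K powr enn2real p)"
proof -
  define P where "P = enn2real p"
  define I where "I = (\<integral>\<^sup>+ \<omega>. ennreal (\<bar>f \<omega>\<bar> powr P) \<partial>M)"
  have P: "P \<ge> 1"
    using assms enn2real_mono[of 1 p] by (simp add: P_def top.not_eq_extremum)
  show ?thesis
  proof (cases "I = \<infinity>")
    case True
    then show ?thesis
      using assms by (auto simp: Lp_norm_def I_def P_def top_unique)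
  next
    case False
    then obtain x where x: "I = ennreal x" "x \<ge> 0" by (cases I) auto
    have "x powr (1 / P) \<le> K \<longleftrightarrow> x \<le> K powr P"
    proof
      assume "x powr (1 / P) \<le> K"
      then have "(x powr (1 / P)) powr P \<le> K powr P"
        using P by (intro powr_mono2) auto
      then show "x \<le> K powr P" using P x by (simp add: powr_powr)
    next
      assume "x \<le> K powr P"
      then have "x powr (1 / P) \<le> (K powr P) powr (1 / P)"
        using P x by (intro powr_mono2) auto
      then show "x powr (1 / P) \<le> K" using P assms by (simp add: powr_powr)
    qed
    then show ?thesis
      using assms x False by (simp add: Lp_norm_def Let_def flip: P_def I_def)
  qed
qed

lemma Lp_norm_cong_AE:
  assumes "f \<in> borel_measurable M" "g \<in> borel_measurable M" "AE \<omega> in M. f \<omega> = g \<omega>"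
  shows "Lp_norm M p f = Lp_norm M p g"
proof -
  have "esssup M (\<lambda>\<omega>. ennreal \<bar>f \<omega>\<bar>) = esssup M (\<lambda>\<omega>. ennreal \<bar>g \<omega>\<bar>)"
    using assms by (intro esssup_AE_cong) auto
  moreover have "(\<integral>\<^sup>+ \<omega>. ennreal (\<bar>f \<omega>\<bar> powr enn2real p) \<partial>M) =
      (\<integral>\<^sup>+ \<omega>. ennreal (\<bar>g \<omega>\<bar> powr enn2real p) \<partial>M)"
    using assms by (intro nn_integral_cong_AE) auto
  ultimately show ?thesis by (simp add: Lp_norm_def)
qed

text \<open>Serves to replace a limit by \<open>limit_rv\<close>, which agrees with it only off a
  null set. Measurability of \<open>L'\<close> is a separate assumption because M may be
  incomplete.\<close>

lemma tendsto_Lp_cong_AE: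
  assumes "tendsto_Lp M p X L" "L' \<in> borel_measurable M" "AE \<omega> in M. L \<omega> = L' \<omega>"
  shows "tendsto_Lp M p X L'"
proof -
  have meas [measurable]: "X n \<in> borel_measurable M" "L \<in> borel_measurable M" for n
    using assms(1) by (auto simp: tendsto_Lp_def Lp_space_def)
  note [measurable] = assms(2)
  have "Lp_norm M p L = Lp_norm M p L'"
    by (rule Lp_norm_cong_AE[OF meas(2) assms(2,3)])
  moreover have "Lp_norm M p (\<lambda>\<omega>. X n \<omega> - L \<omega>) = Lp_norm M p (\<lambda>\<omega>. X n \<omega> - L' \<omega>)" for n
    using assms(3) by (intro Lp_norm_cong_AE) auto
  ultimately show ?thesis
    using assms by (simp add: tendsto_Lp_def Lp_space_def)
qed

section \<open>Series with absolutely summable coefficients in L^p\<close>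

lemma Lp_series_infinity:
  fixes Y :: "nat \<Rightarrow> 'a \<Rightarrow> real"
  assumes Y: "\<And>m. Y m \<in> borel_measurable M" "\<And>m. Lp_norm M \<infinity> (Y m) \<le> ennreal K"
    and K: "0 \<le> K" and c: "summable (\<lambda>m. \<bar>c m\<bar>)"
  shows "AE \<omega> in M. summable (\<lambda>m. \<bar>c m * Y m \<omega>\<bar>)"
    and "Lp_norm M \<infinity> (\<lambda>\<omega>. \<Sum>m. c m * Y m \<omega>) \<le> ennreal ((\<Sum>m. \<bar>c m\<bar>) * K)"
proof -
  note [measurable] = Y(1)
  have "AE \<omega> in M. \<bar>Y m \<omega>\<bar> \<le> K" for m
    using esssup_AE[of "\<lambda>\<omega>. ennreal \<bar>Y m \<omega>\<bar>" M]
  proof eventually_elim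
    case (elim \<omega>)
    also have "esssup M (\<lambda>\<omega>. ennreal \<bar>Y m \<omega>\<bar>) \<le> ennreal K"
      using Y(2)[of m] by (simp add: Lp_norm_def)
    finally show ?case using K by simp
  qed
  \<comment> \<open>Countably many null sets unite to one, off which the series is dominated by K
    times the coefficient series.\<close>
  then have ae: "AE \<omega> in M. \<forall>m. \<bar>Y m \<omega>\<bar> \<le> K"
    by (simp add: AE_all_countable)
  have le: "\<bar>c m * Y m \<omega>\<bar> \<le> \<bar>c m\<bar> * K" if "\<forall>m. \<bar>Y m \<omega>\<bar> \<le> K" for m \<omega>
    using that by (simp add: abs_mult mult_left_mono)
  have cK: "summable (\<lambda>m. \<bar>c m\<bar> * K)"
    using c by (rule summable_mult2)
  have summ: "summable (\<lambda>m. \<bar>c m * Y m \<omega>\<bar>)" if "\<forall>m. \<bar>Y m \<omega>\<bar> \<le> K" for \<omega>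
    by (rule summable_comparison_test'[OF cK]) (use le[OF that] in auto)
  show "AE \<omega> in M. summable (\<lambda>m. \<bar>c m * Y m \<omega>\<bar>)"
    using ae by eventually_elim (rule summ)
  have "AE \<omega> in M. ennreal \<bar>\<Sum>m. c m * Y m \<omega>\<bar> \<le> ennreal ((\<Sum>m. \<bar>c m\<bar>) * K)"
    using ae
  proof eventually_elim
    case (elim \<omega>)
    have "\<bar>\<Sum>m. c m * Y m \<omega>\<bar> \<le> (\<Sum>m. \<bar>c m * Y m \<omega>\<bar>)"
      by (rule summable_rabs[OF summ[OF elim]])
    also have "\<dots> \<le> (\<Sum>m. \<bar>c m\<bar> * K)"
      by (rule suminf_le[OF le[OF elim] summ[OF elim] cK])
    also have "\<dots> = (\<Sum>m. \<bar>c m\<bar>) * K"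
      using suminf_mult2[OF c] by simp
    finally show ?case by (rule ennreal_leI)
  qed
  then show "Lp_norm M \<infinity> (\<lambda>\<omega>. \<Sum>m. c m * Y m \<omega>) \<le> ennreal ((\<Sum>m. \<bar>c m\<bar>) * K)"
    by (simp add: Lp_norm_def esssup_I)
qed

text \<open>The function \<open>G\<close>, the sum of |c_m| |Y_m|^p, has integral at most C * K^p,
  with C the l^1 norm of c, and so is finite almost everywhere. There the weighted power inequality
  bounds the p-th power of the series by C^(p-1) * \<open>G\<close>, and integrating gives (C *
  K)^p.\<close>

lemma Lp_series_finite:
  fixes Y :: "nat \<Rightarrow> 'a \<Rightarrow> real"
  assumes p: "1 \<le> p" "p \<noteq> \<infinity>"
    and Y: "\<And>m. Y m \<in> borel_measurable M" "\<And>m. Lp_norm M p (Y m) \<le> ennreal K"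
    and K: "0 \<le> K" and c: "summable (\<lambda>m. \<bar>c m\<bar>)"
  shows "AE \<omega> in M. summable (\<lambda>m. \<bar>c m * Y m \<omega>\<bar>)"
    and "Lp_norm M p (\<lambda>\<omega>. \<Sum>m. c m * Y m \<omega>) \<le> ennreal ((\<Sum>m. \<bar>c m\<bar>) * K)"
proof -
  note [measurable] = Y(1)
  define P where "P = enn2real p"
  define C where "C = (\<Sum>m. \<bar>c m\<bar>)"
  have P: "P \<ge> 1"
    using p enn2real_mono[of 1 p] by (simp add: P_def top.not_eq_extremum)
  have C: "C \<ge> 0"
    unfolding C_def by (rule suminf_nonneg[OF c]) simp
  define G where "G = (\<lambda>\<omega>. \<Sum>m. ennreal (\<bar>c m\<bar> * \<bar>Y m \<omega>\<bar> powr P))"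
  have G [measurable]: "G \<in> borel_measurable M"
    unfolding G_def by measurable
  have "(\<integral>\<^sup>+ \<omega>. G \<omega> \<partial>M) = (\<Sum>m. ennreal \<bar>c m\<bar> * (\<integral>\<^sup>+ \<omega>. ennreal (\<bar>Y m \<omega>\<bar> powr P) \<partial>M))"
    unfolding G_def by (simp add: nn_integral_suminf ennreal_mult nn_integral_cmult)
  also have "\<dots> \<le> (\<Sum>m. ennreal \<bar>c m\<bar> * ennreal (K powr P))"
    using Y(2) Lp_norm_le_iff_nn_integral[OF p K]
    by (intro suminf_le mult_left_mono) (auto simp: P_def)
  also have "\<dots> = ennreal C * ennreal (K powr P)"
    unfolding C_def using c by (simp add: suminf_ennreal2)
  finally have intG: "(\<integral>\<^sup>+ \<omega>. G \<omega> \<partial>M) \<le> ennreal (C * K powr P)"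
    using C by (simp add: ennreal_mult)
  then have "(\<integral>\<^sup>+ \<omega>. G \<omega> \<partial>M) \<noteq> \<infinity>"
    by (auto simp: top_unique)
  then have fin: "AE \<omega> in M. G \<omega> \<noteq> \<infinity>"
    by (intro nn_integral_PInf_AE) auto
  have summP: "summable (\<lambda>m. \<bar>c m\<bar> * \<bar>Y m \<omega>\<bar> powr P)" if "G \<omega> \<noteq> \<infinity>" for \<omega>
    using that unfolding G_def by (intro summable_suminf_not_top) auto
  have summ: "summable (\<lambda>m. \<bar>c m * Y m \<omega>\<bar>)" if "G \<omega> \<noteq> \<infinity>" for \<omega>
  proof (rule summable_comparison_test'[OF summable_add[OF c summP[OF that]]])
    fix m
    \<comment> \<open>Lets summability of c and of the terms of \<open>G\<close> together dominate
      the original series.\<close>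
    have "\<bar>Y m \<omega>\<bar> \<le> 1 + \<bar>Y m \<omega>\<bar> powr P"
    proof (cases "\<bar>Y m \<omega>\<bar> \<le> 1")
      case True
      then show ?thesis by (smt (verit) powr_ge_zero)
    next
      case False
      then show ?thesis using powr_mono[of 1 P "\<bar>Y m \<omega>\<bar>"] P by simp
    qed
    then have "\<bar>c m\<bar> * \<bar>Y m \<omega>\<bar> \<le> \<bar>c m\<bar> * (1 + \<bar>Y m \<omega>\<bar> powr P)"
      by (rule mult_left_mono) simp
    then show "norm \<bar>c m * Y m \<omega>\<bar> \<le> \<bar>c m\<bar> + \<bar>c m\<bar> * \<bar>Y m \<omega>\<bar> powr P"
      by (simp add: abs_mult algebra_simps)
  qed
  show "AE \<omega> in M. summable (\<lambda>m. \<bar>c m * Y m \<omega>\<bar>)"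
    using fin by eventually_elim (rule summ)
  have "AE \<omega> in M. ennreal (\<bar>\<Sum>m. c m * Y m \<omega>\<bar> powr P) \<le> ennreal (C powr (P - 1)) * G \<omega>"
    using fin
  proof eventually_elim
    case (elim \<omega>)
    define T where "T = (\<Sum>m. \<bar>c m\<bar> * \<bar>Y m \<omega>\<bar> powr P)"
    have GT: "G \<omega> = ennreal T"
      unfolding G_def T_def using summP[OF elim] by (intro suminf_ennreal2) auto
    have partial: "(\<Sum>m<N. \<bar>c m * Y m \<omega>\<bar>) powr P \<le> C powr (P - 1) * T" for N
    proof -
      have "(\<Sum>m<N. \<bar>c m\<bar> * \<bar>Y m \<omega>\<bar>) powr P \<le>
          (\<Sum>m<N. \<bar>c m\<bar>) powr (P - 1) * (\<Sum>m<N. \<bar>c m\<bar> * \<bar>Y m \<omega>\<bar> powr P)"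
        by (rule weighted_sum_powr_le[OF P]) auto
      also have "\<dots> \<le> C powr (P - 1) * T"
        unfolding C_def T_def using P c summP[OF elim]
        by (intro mult_mono powr_mono2 sum_le_suminf sum_nonneg) auto
      finally show ?thesis by (simp add: abs_mult)
    qed
    \<comment> \<open>The sum may be 0; the limit still passes through the power because P > 0 and
      the partial sums are nonnegative.\<close>
    have "(\<lambda>N. (\<Sum>m<N. \<bar>c m * Y m \<omega>\<bar>) powr P) \<longlonglongrightarrow> (\<Sum>m. \<bar>c m * Y m \<omega>\<bar>) powr P"
      using P by (intro tendsto_powr' summable_LIMSEQ summ[OF elim] tendsto_const)
        (auto intro!: always_eventually sum_nonneg)
    then have "(\<Sum>m. \<bar>c m * Y m \<omega>\<bar>) powr P \<le> C powr (P - 1) * T"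
      by (rule LIMSEQ_le_const2) (use partial in auto)
    moreover have "\<bar>\<Sum>m. c m * Y m \<omega>\<bar> powr P \<le> (\<Sum>m. \<bar>c m * Y m \<omega>\<bar>) powr P"
      using P by (intro powr_mono2 summable_rabs summ[OF elim]) auto
    ultimately have "\<bar>\<Sum>m. c m * Y m \<omega>\<bar> powr P \<le> C powr (P - 1) * T" by linarith
    then show ?case
      by (simp add: GT ennreal_leI flip: ennreal_mult')
  qed
  then have "(\<integral>\<^sup>+ \<omega>. ennreal (\<bar>\<Sum>m. c m * Y m \<omega>\<bar> powr P) \<partial>M) \<le>
      (\<integral>\<^sup>+ \<omega>. ennreal (C powr (P - 1)) * G \<omega> \<partial>M)"
    by (rule nn_integral_mono_AE)
  also have "\<dots> = ennreal (C powr (P - 1)) * (\<integral>\<^sup>+ \<omega>. G \<omega> \<partial>M)"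
    by (rule nn_integral_cmult) simp
  also have "\<dots> \<le> ennreal (C powr (P - 1)) * ennreal (C * K powr P)"
    by (rule mult_left_mono[OF intG]) simp
  also have "\<dots> = ennreal ((C * K) powr P)"
  proof -
    have "C powr (P - 1) * C = C powr P"
      using C by (cases "C = 0") (simp_all add: powr_diff)
    then show ?thesis
      using C K by (simp add: powr_mult flip: ennreal_mult' mult.assoc)
  qed
  finally show "Lp_norm M p (\<lambda>\<omega>. \<Sum>m. c m * Y m \<omega>) \<le> ennreal ((\<Sum>m. \<bar>c m\<bar>) * K)"
    using Lp_norm_le_iff_nn_integral[OF p, of "C * K" M "\<lambda>\<omega>. \<Sum>m. c m * Y m \<omega>"] C K
    unfolding P_def C_def by simp
qed

lemma Lp_series:
  fixes Y :: "nat \<Rightarrow> 'a \<Rightarrow> real"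
  assumes p: "1 \<le> p"
    and Y: "\<And>m. Y m \<in> borel_measurable M" "\<And>m. Lp_norm M p (Y m) \<le> ennreal K"
    and K: "0 \<le> K" and c: "summable (\<lambda>m. \<bar>c m\<bar>)"
  shows AE_summable_Lp_series: "AE \<omega> in M. summable (\<lambda>m. \<bar>c m * Y m \<omega>\<bar>)"
    and Lp_norm_series_le:
      "Lp_norm M p (\<lambda>\<omega>. \<Sum>m. c m * Y m \<omega>) \<le> ennreal ((\<Sum>m. \<bar>c m\<bar>) * K)"
  using Lp_series_finite[OF p _ Y K c] Lp_series_infinity[of Y M K c] Y K c
  by (cases "p = \<infinity>"; force)+

lemma series_in_Lp_space:
  fixes Y :: "nat \<Rightarrow> 'a \<Rightarrow> real"
  assumes p: "1 \<le> p"
    and Y: "\<And>m. Y m \<in> borel_measurable M" "\<And>m. Lp_norm M p (Y m) \<le> ennreal K"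
    and K: "0 \<le> K" and c: "summable (\<lambda>m. \<bar>c m\<bar>)"
  shows "(\<lambda>\<omega>. \<Sum>m. c m * Y m \<omega>) \<in> Lp_space M p"
proof -
  note [measurable] = Y(1)
  show ?thesis
    using le_less_trans[OF Lp_norm_series_le[where Y = Y and c = c, OF p Y K c] ennreal_less_top]
    by (simp add: Lp_space_def)
qed

text \<open>Dominated convergence for series (Tannery) gives convergence of the coefficients in l^1,
  and the norm bound applied to the difference series transfers it to L^p. It serves both the
  partial sums of Z and the normalized sums Z_n / s_n.\<close>

lemma tendsto_Lp_series:
  fixes Y :: "nat \<Rightarrow> 'a \<Rightarrow> real"
  assumes p: "1 \<le> p"
    and Y: "\<And>m. Y m \<in> borel_measurable M" "\<And>m. Lp_norm M p (Y m) \<le> ennreal K"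
    and K: "0 \<le> K" and a: "\<And>n. summable (\<lambda>m. \<bar>a n m\<bar>)" and e: "summable (\<lambda>m. \<bar>e m\<bar>)"
    and lim: "\<And>m. (\<lambda>n. a n m) \<longlonglongrightarrow> e m"
    and dom: "\<forall>\<^sub>F n in sequentially. \<forall>m. \<bar>a n m\<bar> \<le> D m" and D: "summable D"
  shows "tendsto_Lp M p (\<lambda>n \<omega>. \<Sum>m. a n m * Y m \<omega>) (\<lambda>\<omega>. \<Sum>m. e m * Y m \<omega>)"
proof -
  note [measurable] = Y(1)
  have ae: "summable (\<lambda>m. \<bar>a n m - e m\<bar>)" for n
    by (rule summable_comparison_test'[OF summable_add[OF a[of n] e]]) auto
  have "(\<lambda>n. \<Sum>m. \<bar>a n m - e m\<bar>) \<longlonglongrightarrow> (\<Sum>m::nat. 0)"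
  proof (rule tannerys_theorem[THEN conjunct2, THEN conjunct2])
    show "(\<lambda>n. \<bar>a n m - e m\<bar>) \<longlonglongrightarrow> 0" for m
      using lim[of m] by (simp add: LIM_zero tendsto_rabs_zero)
    show "\<forall>\<^sub>F (m, n) in at_top \<times>\<^sub>F sequentially. norm \<bar>a n m - e m\<bar> \<le> D m + \<bar>e m\<bar>"
      by (rule eventually_mono[OF eventually_prodI[OF eventually_True dom]])
        (auto simp: case_prod_unfold intro!: order_trans[OF abs_triangle_ineq4] add_right_mono)
    show "summable (\<lambda>m. D m + \<bar>e m\<bar>)"
      by (rule summable_add[OF D e])
  qed simp
  then have "(\<lambda>n. ennreal ((\<Sum>m. \<bar>a n m - e m\<bar>) * K)) \<longlonglongrightarrow> ennreal (0 * K)"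
    by (intro tendsto_ennrealI tendsto_mult_right) simp
  then have bound: "(\<lambda>n. ennreal ((\<Sum>m. \<bar>a n m - e m\<bar>) * K)) \<longlonglongrightarrow> 0"
    by simp
  have "Lp_norm M p (\<lambda>\<omega>. (\<Sum>m. a n m * Y m \<omega>) - (\<Sum>m. e m * Y m \<omega>)) \<le>
      ennreal ((\<Sum>m. \<bar>a n m - e m\<bar>) * K)" for n
  proof -
    \<comment> \<open>Termwise subtraction requires both series to converge, which is known only
      almost everywhere.\<close>
    have "AE \<omega> in M. (\<Sum>m. a n m * Y m \<omega>) - (\<Sum>m. e m * Y m \<omega>) = (\<Sum>m. (a n m - e m) * Y m \<omega>)"
      using AE_summable_Lp_series[where Y = Y and c = "a n", OF p Y K a]
        AE_summable_Lp_series[where Y = Y and c = e, OF p Y K e]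
    proof eventually_elim
      case (elim \<omega>)
      show ?case
        using suminf_diff[OF summable_rabs_cancel[OF elim(1)] summable_rabs_cancel[OF elim(2)]]
        by (simp add: left_diff_distrib)
    qed
    then show ?thesis
      using Lp_norm_series_le[where Y = Y and c = "\<lambda>m. a n m - e m", OF p Y K ae]
      by (subst Lp_norm_cong_AE[where g = "\<lambda>\<omega>. \<Sum>m. (a n m - e m) * Y m \<omega>"]) auto
  qed
  then have "(\<lambda>n. Lp_norm M p (\<lambda>\<omega>. (\<Sum>m. a n m * Y m \<omega>) - (\<Sum>m. e m * Y m \<omega>))) \<longlonglongrightarrow> 0"
    by (intro tendsto_sandwich[OF _ _ tendsto_const bound]) auto
  then show ?thesis
    by (simp add: tendsto_Lp_def series_in_Lp_space[OF p Y K a] series_in_Lp_space[OF p Y K e])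
qed

section \<open>Sequences whose consecutive ratios converge\<close>

lemma ratio_power_LIMSEQ:
  fixes S :: "nat \<Rightarrow> real"
  assumes R: "R > 0" and lim: "(\<lambda>n. S (Suc n) / S n) \<longlonglongrightarrow> R"
  shows "(\<lambda>n. S n / S (n + k)) \<longlonglongrightarrow> (1 / R) ^ k"
proof -
  have nz: "\<forall>\<^sub>F n in sequentially. S n \<noteq> 0"
    using order_tendstoD(1)[OF lim R] by eventually_elim auto
  show ?thesis
  proof (induction k)
    case 0
    show ?case
      by (rule tendsto_eventually) (use nz in eventually_elim, simp)
  next
    case (Suc k)
    have "(\<lambda>n. inverse (S (Suc (n + k)) / S (n + k))) \<longlonglongrightarrow> inverse R"
      using R LIMSEQ_ignore_initial_segment[OF lim, of k] by (intro tendsto_inverse) auto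
    then have "(\<lambda>n. S n / S (n + k) * inverse (S (Suc (n + k)) / S (n + k))) \<longlonglongrightarrow>
        (1 / R) ^ k * inverse R"
      by (intro tendsto_mult Suc)
    \<comment> \<open>The intermediate term cancels only where it is nonzero, hence only
      eventually.\<close>
    moreover have "\<forall>\<^sub>F n in sequentially. S n / S (n + k) * inverse (S (Suc (n + k)) / S (n + k)) =
        S n / S (n + Suc k)"
      using sequentially_offset[OF nz, of k] by eventually_elim (simp add: field_simps)
    ultimately have "(\<lambda>n. S n / S (n + Suc k)) \<longlonglongrightarrow> (1 / R) ^ k * inverse R"
      by (rule Lim_transform_eventually)
    then show ?case
      by (simp add: field_simps)
  qed
qed

text \<open>For a fixed \<open>\<sigma>\<close> strictly between 1 and R, S grows by at least the
  factor \<open>\<sigma>\<close> per step from some index N on, so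
  \<open>\<rho> = 1 / \<sigma>\<close> works there. Monotonicity covers the indices below N, at the
  cost of the constant.\<close>

lemma ratio_geometric_bound:
  fixes S :: "nat \<Rightarrow> real"
  assumes R: "R > 1" and lim: "(\<lambda>n. S (Suc n) / S n) \<longlonglongrightarrow> R"
    and mono: "mono S" and nonneg: "\<And>n. S n \<ge> 0"
  obtains \<rho> C where "0 < \<rho>" "\<rho> < 1"
    "\<forall>\<^sub>F n in sequentially. \<forall>m\<le>n. S m / S n \<le> C * \<rho> ^ (n - m)"
proof -
  obtain \<sigma> where \<sigma>: "1 < \<sigma>" "\<sigma> < R" using dense[OF R] by blast
  define \<rho> where "\<rho> = 1 / \<sigma>"
  have \<rho>: "0 < \<rho>" "\<rho> < 1" using \<sigma> by (auto simp: \<rho>_def)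
  obtain N where N: "\<And>n. n \<ge> N \<Longrightarrow> S (Suc n) / S n > \<sigma>"
    using order_tendstoD(1)[OF lim \<sigma>(2)] by (auto simp: eventually_sequentially)
  \<comment> \<open>Division by zero yields 0, so a ratio above \<open>\<sigma>\<close> rules out a
    zero denominator.\<close>
  have pos: "S n > 0" if "n \<ge> N" for n
    using N[OF that] nonneg[of n] \<sigma> by (cases "S n = 0") auto
  have step: "S n \<le> \<rho> * S (Suc n)" if "n \<ge> N" for n
    using N[OF that] pos[OF that] \<sigma> by (simp add: \<rho>_def field_simps)
  have iter: "S m \<le> \<rho> ^ j * S (m + j)" if "m \<ge> N" for m j
  proof (induction j)
    case (Suc j)
    also have "\<rho> ^ j * S (m + j) \<le> \<rho> ^ j * (\<rho> * S (Suc (m + j)))"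
      using step[of "m + j"] that \<rho> by (intro mult_left_mono) auto
    finally show ?case by (simp add: mult_ac)
  qed simp
  \<comment> \<open>Starting from \<open>max m N\<close> instead of m loses at most N factors
    \<open>\<rho>\<close>, which \<open>(1 / \<rho>) ^ N\<close> restores.\<close>
  have "S m / S n \<le> (1 / \<rho>) ^ N * \<rho> ^ (n - m)" if "m \<le> n" "n \<ge> N" for m n
  proof -
    define j where "j = n - max m N"
    have "S m \<le> S (max m N)" using mono by (simp add: monoD)
    also have "\<dots> \<le> \<rho> ^ j * S n"
      using iter[of "max m N" j] that by (simp add: j_def)
    finally have "S m / S n \<le> \<rho> ^ j"
      using pos[OF \<open>n \<ge> N\<close>] by (simp add: field_simps)
    also have "\<rho> ^ j = (1 / \<rho>) ^ N * \<rho> ^ (N + j)"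
      using \<rho> by (simp add: power_add power_divide)
    also have "\<dots> \<le> (1 / \<rho>) ^ N * \<rho> ^ (n - m)"
      using \<rho> by (intro mult_left_mono power_decreasing) (auto simp: j_def)
    finally show ?thesis .
  qed
  then show thesis
    using that[OF \<rho>, of "(1 / \<rho>) ^ N"] by (auto simp: eventually_sequentially)
qed

section \<open>The weight norms s_n and the limits of the normalized weights\<close>

lemma weight_norm_nonneg: "weight_norm \<beta> n \<ge> 0"
  by (simp add: weight_norm_def sum_nonneg)

lemma weight_norm_Suc: "(weight_norm \<beta> (Suc n))\<^sup>2 = (weight_norm \<beta> n)\<^sup>2 + (\<beta> n)\<^sup>2"
  by (simp add: weight_norm_def sum_nonneg)

lemma mono_weight_norm: "mono (weight_norm \<beta>)"
  by (rule incseq_SucI) (simp add: weight_norm_def)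

lemma abs_le_weight_norm: "m < n \<Longrightarrow> \<bar>\<beta> m\<bar> \<le> weight_norm \<beta> n"
  unfolding weight_norm_def by (rule real_le_rsqrt) (auto intro: member_le_sum)

text \<open>The growth hypothesis at n + 1 is divided by the one at n; slow variation enters with
  the factor b along x = b^n, which tends to infinity. This gives the limit of the squared ratio,
  and a square root finishes.\<close>

lemma weight_norm_ratio_LIMSEQ:
  assumes "b > 1" "slowly_varying l"
    and lim: "(\<lambda>n. (weight_norm \<beta> n)\<^sup>2 / (2 powr (2 * q * real n) * l (b ^ n))) \<longlonglongrightarrow> 1"
  shows "(\<lambda>n. weight_norm \<beta> (Suc n) / weight_norm \<beta> n) \<longlonglongrightarrow> 2 powr q"
proof -
  define A where "A = (\<lambda>n. 2 powr (2 * q * real n) * l (b ^ n))"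
  define u where "u = (\<lambda>n. (weight_norm \<beta> n)\<^sup>2 / A n)"
  have l: "l x > 0" if "x \<ge> 0" for x
    using assms(2) that by (simp add: slowly_varying_def regularly_varying_def)
  have A: "A n > 0" for n using l[of "b ^ n"] \<open>b > 1\<close> by (simp add: A_def)
  have u: "u \<longlonglongrightarrow> 1" using lim by (simp add: u_def A_def)
  have "\<forall>\<^sub>F n in sequentially. 0 < inverse (b ^ n)"
    using \<open>b > 1\<close> by simp
  from filterlim_inverse_at_top[OF LIMSEQ_inverse_realpow_zero[OF \<open>b > 1\<close>] this]
  have pow: "filterlim (\<lambda>n. b ^ n) at_top sequentially" by simp
  have "((\<lambda>x. l (b * x) / l x) \<longlongrightarrow> b powr 0) at_top"
    using assms(1,2) unfolding slowly_varying_def regularly_varying_def by simp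
  from filterlim_compose[OF this pow] have "(\<lambda>n. l (b * b ^ n) / l (b ^ n)) \<longlonglongrightarrow> 1"
    using \<open>b > 1\<close> by simp
  then have "(\<lambda>n. u (Suc n) / u n * (2 powr (2 * q) * (l (b * b ^ n) / l (b ^ n)))) \<longlonglongrightarrow>
      1 / 1 * (2 powr (2 * q) * 1)"
    using u by (intro tendsto_intros LIMSEQ_Suc) auto
  \<comment> \<open>Holds for every n: if s_n = 0, both sides are 0 by the convention for
    division.\<close>
  moreover have "u (Suc n) / u n * (2 powr (2 * q) * (l (b * b ^ n) / l (b ^ n))) =
      (weight_norm \<beta> (Suc n) / weight_norm \<beta> n)\<^sup>2" for n
  proof -
    have "2 powr (2 * q) * (l (b * b ^ n) / l (b ^ n)) = A (Suc n) / A n"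
      by (simp add: A_def algebra_simps powr_add)
    then show ?thesis
      using A[of n] A[of "Suc n"] by (simp add: u_def power_divide)
  qed
  ultimately have "(\<lambda>n. (weight_norm \<beta> (Suc n) / weight_norm \<beta> n)\<^sup>2) \<longlonglongrightarrow> (2 powr q)\<^sup>2"
    by (simp add: power2_eq_square flip: powr_add)
  from tendsto_real_sqrt[OF this] show ?thesis
    by (simp add: weight_norm_nonneg)
qed

text \<open>After a shift the quotient factors as (\<beta>_n / s_n) * (s_n / s_{n+k+1}). As
  \<beta>_n is nonnegative, the first factor is the square root of (s_{n+1} / s_n)^2 - 1; the second
  is a product of k + 1 inverse ratios.\<close>

lemma normalized_weight_LIMSEQ:
  fixes \<beta> :: "nat \<Rightarrow> real"
  assumes \<beta>: "\<And>m. \<beta> m \<ge> 0" and R: "R > 1"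
    and lim: "(\<lambda>n. weight_norm \<beta> (Suc n) / weight_norm \<beta> n) \<longlonglongrightarrow> R"
  shows "(\<lambda>n. \<beta> (n - Suc k) / weight_norm \<beta> n) \<longlonglongrightarrow> sqrt (R\<^sup>2 - 1) * (1 / R) ^ Suc k"
\<comment> \<open>The shift discards the finitely many n at which \<open>n - Suc k\<close> is
  truncated.\<close>
proof (rule LIMSEQ_offset[where k = "Suc k"])
  define S where "S = weight_norm \<beta>"
  have lim': "(\<lambda>n. S (Suc n) / S n) \<longlonglongrightarrow> R" using lim by (simp add: S_def)
  have nz: "\<forall>\<^sub>F n in sequentially. S n \<noteq> 0"
    using order_tendstoD(1)[OF lim', of 0] R by (auto elim: eventually_mono)
  have "(\<lambda>n. sqrt ((S (Suc n) / S n)\<^sup>2 - 1) * (S n / S (n + Suc k))) \<longlonglongrightarrow>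
      sqrt (R\<^sup>2 - 1) * (1 / R) ^ Suc k"
    using R by (intro tendsto_intros lim' ratio_power_LIMSEQ) auto
  moreover have "\<forall>\<^sub>F n in sequentially. sqrt ((S (Suc n) / S n)\<^sup>2 - 1) * (S n / S (n + Suc k)) =
      \<beta> n / S (n + Suc k)"
    using nz
  proof eventually_elim
    case (elim n)
    have "(S (Suc n) / S n)\<^sup>2 - 1 = (\<beta> n / S n)\<^sup>2"
      using elim weight_norm_Suc[of \<beta> n] by (simp add: S_def power_divide field_simps)
    then show ?case
      using elim \<beta>[of n] weight_norm_nonneg[of \<beta> n] by (simp add: S_def)
  qed
  ultimately have "(\<lambda>n. \<beta> n / S (n + Suc k)) \<longlonglongrightarrow> sqrt (R\<^sup>2 - 1) * (1 / R) ^ Suc k"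
    by (rule Lim_transform_eventually)
  then show "(\<lambda>n. \<beta> (n + Suc k - Suc k) / weight_norm \<beta> (n + Suc k)) \<longlonglongrightarrow>
      sqrt (R\<^sup>2 - 1) * (1 / R) ^ Suc k"
    by (simp add: S_def)
qed

section \<open>Finite sums as series, and convergence to Z\<close>

text \<open>Padding with zeros brings finite sums of growing length into the form required by
  \<open>tendsto_Lp_series\<close>.\<close>

lemma suminf_truncated:
  fixes f y :: "nat \<Rightarrow> real"
  shows "(\<Sum>m. (if m < n then f m else 0) * y m) = (\<Sum>m<n. f m * y m)"
  using suminf_finite[of "{..<n}" "\<lambda>m. (if m < n then f m else 0) * y m"] by simp

text \<open>The first two conjuncts justify reading \<open>limit_rv\<close> as the infinite series,
  both pointwise almost everywhere and in L^p; the third is the convergence of Z_n / s_n.\<close>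

theorem theorem2p1:
  fixes M :: "'a measure" and p :: ennreal and Y :: "nat \<Rightarrow> 'a \<Rightarrow> real"
    and \<beta> :: "nat \<Rightarrow> real" and q b :: real and l :: "real \<Rightarrow> real"
  assumes "prob_space M"
    and "1 \<le> p"
    and "\<And>m. m \<ge> 1 \<Longrightarrow> Y m \<in> Lp_space M p"
    and "(SUP m\<in>{1..}. Lp_norm M p (Y m)) < \<infinity>"
    and "\<And>m. \<beta> m \<ge> 0"
    and "q > 0" and "b > 1" and "slowly_varying l"
    and "(\<lambda>n. (weight_norm \<beta> n)\<^sup>2 / (2 powr (2 * q * real n) * l (b ^ n))) \<longlonglongrightarrow> 1"
  shows "(AE \<omega> in M. summable (\<lambda>m. 2 powr (- q * real (Suc m)) * Y (Suc m) \<omega>)) \<and>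
         tendsto_Lp M p
           (\<lambda>N \<omega>. sqrt (2 powr (2 * q) - 1) * (\<Sum>m=1..N. 2 powr (- q * real m) * Y m \<omega>))
           (limit_rv q Y) \<and>
         tendsto_Lp M p (\<lambda>n \<omega>. 1 / weight_norm \<beta> n * weighted_sum \<beta> Y n \<omega>) (limit_rv q Y)"
proof -
  define R where "R = 2 powr q"
  define S where "S = weight_norm \<beta>"
  \<comment> \<open>Indices are shifted to start at 0, as \<open>suminf\<close> does;
    \<open>g m\<close> is thus the coefficient belonging to Y_{m+1}.\<close>
  define y where "y = (\<lambda>m. Y (Suc m))"
  define g where "g = (\<lambda>m. 2 powr (- q * real (Suc m)))"
  define r where "r = sqrt (2 powr (2 * q) - 1)"
  have R: "R > 1" using \<open>q > 0\<close> by (simp add: R_def)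
  have r: "r = sqrt (R\<^sup>2 - 1)"
    by (simp add: r_def R_def power2_eq_square flip: powr_add)
  have g: "g m = (1 / R) ^ Suc m" for m
  proof -
    have "g m = (2 powr (- q)) powr real (Suc m)" by (simp add: g_def powr_powr)
    also have "\<dots> = (2 powr (- q)) ^ Suc m" by (rule powr_realpow) simp
    finally show ?thesis by (simp add: R_def powr_minus_divide)
  qed
  have summ_g: "summable (\<lambda>m. \<bar>c * g m\<bar>)" for c
    unfolding g using R
    by (simp add: abs_mult power_abs summable_geometric summable_mult del: abs_power_minus)
  have Y1: "y m \<in> borel_measurable M" for m
    using assms(3)[of "Suc m"] by (simp add: y_def Lp_space_def)
  obtain K where K: "(SUP m\<in>{1..}. Lp_norm M p (Y m)) = ennreal K" "0 \<le> K"
    using assms(4) by (metis infinity_ennreal_def less_top_ennreal)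
  have Y2: "Lp_norm M p (y m) \<le> ennreal K" for m
    unfolding K(1)[symmetric] y_def by (rule SUP_upper) simp
  note series = assms(2) Y1 Y2 K(2)

  have AE: "AE \<omega> in M. summable (\<lambda>m. g m * y m \<omega>)"
    using AE_summable_Lp_series[where Y = y and c = g, OF series] summ_g[of 1]
    by (auto elim!: eventually_mono intro: summable_rabs_cancel)

  have truncated: "summable (\<lambda>m. \<bar>if m < n then f m else 0\<bar>)" for n and f :: "nat \<Rightarrow> real"
    by (rule summable_finite[of "{..<n}"]) auto

  \<comment> \<open>Only almost everywhere: where the series diverges, the factor \<open>r\<close> cannot be moved into
    the unspecified value of the sum.\<close>
  have limit: "AE \<omega> in M. (\<Sum>m. r * g m * y m \<omega>) = limit_rv q Y \<omega>"
    using AE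
  proof eventually_elim
    case (elim \<omega>)
    show ?case
      using suminf_mult[OF elim, of r] by (simp add: limit_rv_def r_def g_def y_def mult.assoc)
  qed
  \<comment> \<open>\<open>suminf\<close> of measurable functions is measurable even where the
    series diverges.\<close>
  have meas: "limit_rv q Y \<in> borel_measurable M"
    unfolding limit_rv_def[abs_def] using Y1 unfolding y_def by measurable

  \<comment> \<open>Partial sums of Z: the coefficients are cut off at n, so the limiting
    coefficients dominate them.\<close>
  have "tendsto_Lp M p (\<lambda>n \<omega>. \<Sum>m. (if m < n then r * g m else 0) * y m \<omega>)
      (\<lambda>\<omega>. \<Sum>m. r * g m * y m \<omega>)"
  proof (rule tendsto_Lp_series[where D = "\<lambda>m. \<bar>r * g m\<bar>",
        OF series truncated summ_g _ _ summ_g])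
    show "(\<lambda>n. if m < n then r * g m else 0) \<longlonglongrightarrow> r * g m" for m
      by (rule tendsto_eventually) (use eventually_gt_at_top[of m] in eventually_elim, simp)
    show "\<forall>\<^sub>F n in sequentially. \<forall>m. \<bar>if m < n then r * g m else 0\<bar> \<le> \<bar>r * g m\<bar>"
      by simp
  qed
  moreover have "(\<Sum>m. (if m < n then r * g m else 0) * y m \<omega>) =
      r * (\<Sum>m=1..n. 2 powr (- q * real m) * Y m \<omega>)" for n \<omega>
    by (simp add: suminf_truncated sum.atLeast1_atMost_eq sum_distrib_left mult.assoc g_def y_def)
  ultimately have "tendsto_Lp M p (\<lambda>n \<omega>. r * (\<Sum>m=1..n. 2 powr (- q * real m) * Y m \<omega>))
      (\<lambda>\<omega>. \<Sum>m. r * g m * y m \<omega>)"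
    by (simp only:)
  then have partial: "tendsto_Lp M p
      (\<lambda>n \<omega>. r * (\<Sum>m=1..n. 2 powr (- q * real m) * Y m \<omega>)) (limit_rv q Y)"
    by (rule tendsto_Lp_cong_AE[OF _ meas limit])

  have ratio: "(\<lambda>n. S (Suc n) / S n) \<longlonglongrightarrow> R"
    unfolding S_def R_def by (rule weight_norm_ratio_LIMSEQ[OF assms(7-9)])
  have S: "mono S" "\<And>n. S n \<ge> 0"
    by (simp_all add: S_def mono_weight_norm weight_norm_nonneg)
  obtain \<rho> C where \<rho>: "0 < \<rho>" "\<rho> < 1"
    and bound: "\<forall>\<^sub>F n in sequentially. \<forall>m\<le>n. S m / S n \<le> C * \<rho> ^ (n - m)"
    using ratio_geometric_bound[OF R ratio S] by blast
  \<comment> \<open>The cutoff is essential: for m \<ge> n the truncated index would give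
    \<open>\<beta> 0 / S n\<close> instead of 0.\<close>
  have "tendsto_Lp M p (\<lambda>n \<omega>. \<Sum>m. (if m < n then \<beta> (n - Suc m) / S n else 0) * y m \<omega>)
      (\<lambda>\<omega>. \<Sum>m. r * g m * y m \<omega>)"
  proof (rule tendsto_Lp_series[where D = "\<lambda>m. \<bar>C\<bar> * \<rho> ^ m",
        OF series truncated summ_g])
    fix m
    have "(\<lambda>n. \<beta> (n - Suc m) / S n) \<longlonglongrightarrow> r * g m"
      unfolding r g S_def
      by (rule normalized_weight_LIMSEQ[OF assms(5) R ratio[unfolded S_def]])
    moreover have "\<forall>\<^sub>F n in sequentially. \<beta> (n - Suc m) / S n =
        (if m < n then \<beta> (n - Suc m) / S n else 0)"
      using eventually_gt_at_top[of m] by eventually_elim simp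
    ultimately show "(\<lambda>n. if m < n then \<beta> (n - Suc m) / S n else 0) \<longlonglongrightarrow> r * g m"
      by (rule Lim_transform_eventually)
  next
    show "\<forall>\<^sub>F n in sequentially. \<forall>m. \<bar>if m < n then \<beta> (n - Suc m) / S n else 0\<bar> \<le> \<bar>C\<bar> * \<rho> ^ m"
      using bound
    proof eventually_elim
      case (elim n)
      \<comment> \<open>The square of \<open>\<beta> (n - Suc m)\<close> is one summand of that of
        \<open>S (n - m)\<close>, and \<open>bound\<close> at index \<open>n - m\<close> leaves
        exactly the power m. The absolute value is there because the sign of C is not
        recorded.\<close>
      have "\<beta> (n - Suc m) / S n \<le> \<bar>C\<bar> * \<rho> ^ m" if "m < n" for m
      proof -
        have "\<beta> (n - Suc m) / S n \<le> S (n - m) / S n"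
          using abs_le_weight_norm[OF diff_less_mono2[OF lessI that], of \<beta>]
          by (intro divide_right_mono) (auto simp: S_def weight_norm_nonneg)
        also have "\<dots> \<le> C * \<rho> ^ (n - (n - m))" using elim by simp
        also have "\<dots> \<le> \<bar>C\<bar> * \<rho> ^ m" using that \<rho> by (simp add: mult_right_mono)
        finally show ?thesis .
      qed
      then show ?case
        using assms(5) weight_norm_nonneg[of \<beta> n] \<rho> by (simp add: S_def)
    qed
    show "summable (\<lambda>m. \<bar>C\<bar> * \<rho> ^ m)"
      using \<rho> by (intro summable_mult summable_geometric) auto
  qed
  \<comment> \<open>This includes any n with s_n = 0, where both sides are 0.\<close>
  moreover have "(\<Sum>m. (if m < n then \<beta> (n - Suc m) / S n else 0) * y m \<omega>) =
      1 / weight_norm \<beta> n * weighted_sum \<beta> Y n \<omega>" for n \<omega>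
    by (simp add: suminf_truncated sum.atLeast1_atMost_eq weighted_sum_def sum_distrib_left S_def y_def)
  ultimately have "tendsto_Lp M p (\<lambda>n \<omega>. 1 / weight_norm \<beta> n * weighted_sum \<beta> Y n \<omega>)
      (\<lambda>\<omega>. \<Sum>m. r * g m * y m \<omega>)"
    by (simp only:)
  then have "tendsto_Lp M p (\<lambda>n \<omega>. 1 / weight_norm \<beta> n * weighted_sum \<beta> Y n \<omega>) (limit_rv q Y)"
    by (rule tendsto_Lp_cong_AE[OF _ meas limit])
  then show ?thesis
    using AE partial by (simp add: g_def y_def r_def)
qed

end
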